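(* Let $(v_j,\sigma_j^2)_j$ be the eigenvectors and eigenvalues of $A=\mathcal{A}^*\mathcal{A}$, let $L\in[0,1)$ and let $\varphi_\theta=\mathrm{Id}-f_\theta$ be an iResNet which solves the training problem $$\min_{\theta\in\Theta}\ \frac1N\sum_{i=1}^N\|\varphi_\theta(x^{(i)})-Ax^{(i)}\|^2\quad\text{s.t. }\mathrm{Lip}(f_\theta)\leqslant L,$$ where (i) $f_\theta(x)=Wx+b$ with $\theta=(W,b)$ and $$\Theta=\Big\{(W,b)\in L(X)\times X\ \Big|\ \exists (w_j)_{j\in\mathbb{N}},(b_j)_{j\in\mathbb{N}}:\ W=\sum_{j\in\mathbb{N}}w_j\langle\cdot,v_j\rangle v_j,\ b=\sum_{j\in\mathbb{N}}b_jv_j\Big\},$$ (ii) the training dataset $\{x^{(i)}\}_{i\in\{1,\dots,N\}}\subset X$ and the mean values $\mu_j=\frac1N\sum_{i=1}^N\langle x^{(i)},v_j\rangle$ fulfill: for every $j\in\mathbb{N}$ there is $i\in\{1,\dots,N\}$ with $\langle x^{(i)},v_j\rangle\neq\mu_j$. Then the solution of the training problem is $w_j=\min\{1-\sigma_j^2,L\}$, $b_j=\max\{0,1-L-\sigma_j^2\}\,\mu_j$, and $\varphi_\theta^{-1}\circ\mathcal{A}^*$ is equal to the operator $T_L:Y\to X$, $$T_L(y)=\hat b_L+\sum_{j\in\mathbb{N}}\hat r_L(\sigma_j^2)\,\sigma_j\langle y,u_j\rangle v_j,$$ with $$\hat r_L(\sigma^2)=\frac{1}{\max\{\sigma^2,1-L\}},\qquad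 \hat b_L=\frac{1}{1-L}\sum_{j\in\mathbb{N}}b_jv_j=\sum_{\sigma_j^2<1-L}\frac{1-L-\sigma_j^2}{1-L}\,\mu_jv_j.$$
   Context: $X,Y$ are Hilbert spaces and $\mathcal{A}:X\to Y$ is a bounded linear operator with $\|\mathcal{A}\|=1$. $\mathcal{A}$ is assumed to have a singular value decomposition $(u_j,v_j,\sigma_j)_{j\in\mathbb{N}}$ (finitely many $j$ if the range is finite-dimensional), i.e. $\mathcal{A}x=\sum_j\sigma_j\langle x,v_j\rangle u_j$ with $\sigma_j>0$, $(u_j)$ orthonormal in $Y$ and $(v_j)$ an orthonormal basis of $\mathcal{N}(\mathcal{A})^\perp$; hence $\sigma_j\in(0,1]$, and $(v_j,\sigma_j^2)$ are the eigenvectors and (non-zero) eigenvalues of $A=\mathcal{A}^*\mathcal{A}$. $L(X)$ denotes the bounded linear operators on $X$, and $\mathrm{Lip}(f)$ the Lipschitz constant of $f:X\to X$. An iResNet is a map $\varphi_\theta=\mathrm{Id}-f_\theta$ with $\mathrm{Lip}(f_\theta)\leqslant L<1$; it is bijective on $X$. *)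

theory Defs
  imports "HOL-Analysis.Analysis"
begin

text \<open>
  Hilbert spaces are types of the classes \<open>real_inner\<close> and \<open>complete_space\<close>, and \<open>L(X)\<close> is the type
  of bounded linear operators on \<open>X\<close>. The index set \<open>J\<close> of the singular system is any set of natural
  numbers, which covers both the infinite case and the case of a finite-dimensional range. All series
  are series of mutually orthogonal vectors, for which unconditional convergence (\<open>has_sum\<close>) and
  convergence of the sequence of partial sums coincide.
\<close>

definition orthonormal_family :: "nat set \<Rightarrow> (nat \<Rightarrow> 'a::real_inner) \<Rightarrow> bool" where
  "orthonormal_family J e \<longleftrightarrow> (\<forall>i\<in>J. \<forall>j\<in>J. e i \<bullet> e j = (if i = j then 1 else 0))"

definition orthonormal_basis_of :: "nat set \<Rightarrow> (nat \<Rightarrow> 'a::real_inner) \<Rightarrow> 'a set \<Rightarrow> bool" where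
  "orthonormal_basis_of J e S \<longleftrightarrow> orthonormal_family J e \<and> closure (span (e ` J)) = S"

definition singular_system ::
  "('x::{real_inner,complete_space} \<Rightarrow>\<^sub>L 'y::{real_inner,complete_space})
    \<Rightarrow> nat set \<Rightarrow> (nat \<Rightarrow> 'y) \<Rightarrow> (nat \<Rightarrow> 'x) \<Rightarrow> (nat \<Rightarrow> real) \<Rightarrow> bool" where
  "singular_system \<A> J u v \<sigma> \<longleftrightarrow>
     (\<forall>j\<in>J. 0 < \<sigma> j) \<and>
     orthonormal_family J u \<and>
     orthonormal_basis_of J v ({x. blinfun_apply \<A> x = 0}\<^sup>\<bottom>) \<and>
     (\<forall>x. ((\<lambda>j. (\<sigma> j * (x \<bullet> v j)) *\<^sub>R u j) has_sum blinfun_apply \<A> x) J)"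

text \<open>\<open>W = \<Sum>\<^sub>j w\<^sub>j \<langle>\<cdot>, v\<^sub>j\<rangle> v\<^sub>j\<close> and \<open>b = \<Sum>\<^sub>j b\<^sub>j v\<^sub>j\<close>. The operator series is understood pointwise;
  convergence in the operator norm would force \<open>w\<^sub>j \<longlonglongrightarrow> 0\<close> when \<open>J\<close> is infinite, which the optimal weights
  \<open>min {1 - \<sigma>\<^sub>j\<^sup>2, L}\<close> in general violate.\<close>

definition diagonal_params ::
  "nat set \<Rightarrow> (nat \<Rightarrow> 'x::{real_inner,complete_space})
    \<Rightarrow> (nat \<Rightarrow> real) \<Rightarrow> (nat \<Rightarrow> real) \<Rightarrow> ('x \<Rightarrow>\<^sub>L 'x) \<Rightarrow> 'x \<Rightarrow> bool" where
  "diagonal_params J v w \<beta> W b \<longleftrightarrow>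
     (\<forall>x. ((\<lambda>j. (w j * (x \<bullet> v j)) *\<^sub>R v j) has_sum blinfun_apply W x) J) \<and>
     ((\<lambda>j. \<beta> j *\<^sub>R v j) has_sum b) J"

definition Theta ::
  "nat set \<Rightarrow> (nat \<Rightarrow> 'x::{real_inner,complete_space}) \<Rightarrow> (('x \<Rightarrow>\<^sub>L 'x) \<times> 'x) set" where
  "Theta J v = {(W, b). \<exists>w \<beta>. diagonal_params J v w \<beta> W b}"

definition residual_fn :: "('x::real_normed_vector \<Rightarrow>\<^sub>L 'x) \<times> 'x \<Rightarrow> 'x \<Rightarrow> 'x" where
  "residual_fn \<theta> x = blinfun_apply (fst \<theta>) x + snd \<theta>"

definition resnet :: "('x::real_normed_vector \<Rightarrow>\<^sub>L 'x) \<times> 'x \<Rightarrow> 'x \<Rightarrow> 'x" where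
  "resnet \<theta> x = x - residual_fn \<theta> x"

definition training_loss ::
  "('x::{real_inner,complete_space} \<Rightarrow>\<^sub>L 'y::{real_inner,complete_space})
    \<Rightarrow> nat \<Rightarrow> (nat \<Rightarrow> 'x) \<Rightarrow> ('x \<Rightarrow>\<^sub>L 'x) \<times> 'x \<Rightarrow> real" where
  "training_loss \<A> N x \<theta> =
     1 / real N * (\<Sum>i=1..N. (norm (resnet \<theta> (x i)
        - (adjoint (blinfun_apply \<A>) \<circ> blinfun_apply \<A>) (x i)))\<^sup>2)"

definition training_solution ::
  "('x::{real_inner,complete_space} \<Rightarrow>\<^sub>L 'y::{real_inner,complete_space})
    \<Rightarrow> nat set \<Rightarrow> (nat \<Rightarrow> 'x) \<Rightarrow> real \<Rightarrow> nat \<Rightarrow> (nat \<Rightarrow> 'x) \<Rightarrow> ('x \<Rightarrow>\<^sub>L 'x) \<times> 'x \<Rightarrow> bool" where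
  "training_solution \<A> J v L N x \<theta> \<longleftrightarrow>
     is_arg_min (training_loss \<A> N x)
       (\<lambda>\<theta>. \<theta> \<in> Theta J v \<and> L-lipschitz_on UNIV (residual_fn \<theta>)) \<theta>"

definition data_mean :: "(nat \<Rightarrow> 'x::real_inner) \<Rightarrow> nat \<Rightarrow> (nat \<Rightarrow> 'x) \<Rightarrow> nat \<Rightarrow> real" where
  "data_mean v N x j = 1 / real N * (\<Sum>i=1..N. x i \<bullet> v j)"

definition w_opt :: "real \<Rightarrow> (nat \<Rightarrow> real) \<Rightarrow> nat \<Rightarrow> real" where
  "w_opt L \<sigma> j = min (1 - (\<sigma> j)\<^sup>2) L"

definition b_opt :: "real \<Rightarrow> (nat \<Rightarrow> real) \<Rightarrow> (nat \<Rightarrow> real) \<Rightarrow> nat \<Rightarrow> real" where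
  "b_opt L \<sigma> \<mu> j = max 0 (1 - L - (\<sigma> j)\<^sup>2) * \<mu> j"

text \<open>The argument \<open>s\<close> stands for \<open>\<sigma>\<^sup>2\<close>.\<close>

definition r_hat :: "real \<Rightarrow> real \<Rightarrow> real" where
  "r_hat L s = 1 / max s (1 - L)"

definition b_hat ::
  "nat set \<Rightarrow> (nat \<Rightarrow> 'x::{real_inner,complete_space}) \<Rightarrow> (nat \<Rightarrow> real) \<Rightarrow> real \<Rightarrow> (nat \<Rightarrow> real) \<Rightarrow> 'x" where
  "b_hat J v \<sigma> L \<mu> = (1 / (1 - L)) *\<^sub>R (\<Sum>\<^sub>\<infinity>j\<in>J. b_opt L \<sigma> \<mu> j *\<^sub>R v j)"

definition T_op ::
  "nat set \<Rightarrow> (nat \<Rightarrow> 'y::{real_inner,complete_space}) \<Rightarrow> (nat \<Rightarrow> 'x::{real_inner,complete_space})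
    \<Rightarrow> (nat \<Rightarrow> real) \<Rightarrow> real \<Rightarrow> (nat \<Rightarrow> real) \<Rightarrow> 'y \<Rightarrow> 'x" where
  "T_op J u v \<sigma> L \<mu> y =
     b_hat J v \<sigma> L \<mu> + (\<Sum>\<^sub>\<infinity>j\<in>J. (r_hat L ((\<sigma> j)\<^sup>2) * \<sigma> j * (y \<bullet> u j)) *\<^sub>R v j)"

end

theory Submission
  imports Defs
begin

text \<open>In the coordinates given by the \<open>v\<^sub>j\<close>, both \<open>A = \<A>\<^sup>* \<A>\<close> and an admissible network are diagonal: the
  first multiplies by \<open>\<sigma>\<^sub>j\<^sup>2\<close>, the second is \<open>t \<mapsto> (1 - w\<^sub>j) t - \<beta>\<^sub>j\<close>, and the Lipschitz constraint reads
  \<open>\<bar>w\<^sub>j\<bar> \<le> L\<close> for every \<open>j\<close> (\<open>diagonal_residual_lipschitz_iff\<close>). So training splits into independent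
  one-dimensional linear regressions. Ideally \<open>w\<^sub>j = 1 - \<sigma>\<^sub>j\<^sup>2\<close> and \<open>\<beta>\<^sub>j = 0\<close>; where this \<open>w\<^sub>j\<close> exceeds \<open>L\<close>, the
  weight is capped at \<open>L\<close> and the offset is chosen so that the error vanishes at the mean \<open>\<mu>\<^sub>j\<close>.

  Instead of splitting the norm of the loss, which would also involve the component of the data in the
  null space of \<open>\<A>\<close>, optimality is shown as a variational inequality: \<open>training_loss_gap\<close> bounds the excess
  loss of any admissible network from below by its mean squared output distance, over the data, to the
  claimed optimum. This gives minimality at once. It also gives uniqueness, because the data are not constant
  in any coordinate and hence determine the slope and the offset (\<open>diagonal_params_determined_by_data\<close>).
  That the claimed optimum is itself an admissible network amounts to the convergence of orthonormal
  series whose coefficients are a bounded multiple of Fourier coefficients (\<open>diagonal_operator_exists\<close>).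

  The network is bijective by Banach's fixed point theorem, so identifying its inverse on the range
  of \<open>\<A>\<^sup>*\<close> only requires the identity \<open>\<phi>\<^sub>\<theta> (T_op y) = \<A>\<^sup>* y\<close>, which is a computation with
  coefficients (\<open>resnet_T_op\<close>).\<close>

section \<open>Orthonormal series and diagonal operators\<close>

lemma orthonormal_family_norm_sum:
  assumes "orthonormal_family J e" "finite F" "F \<subseteq> J"
  shows "(norm (\<Sum>j\<in>F. c j *\<^sub>R e j))\<^sup>2 = (\<Sum>j\<in>F. (c j)\<^sup>2)"
proof -
  have *: "e i \<bullet> e j = (if i = j then 1 else 0)" if "i \<in> F" "j \<in> F" for i j
    using assms that unfolding orthonormal_family_def by blast
  have "(norm (\<Sum>j\<in>F. c j *\<^sub>R e j))\<^sup>2 = (\<Sum>j\<in>F. (norm (c j *\<^sub>R e j))\<^sup>2)"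
    using assms(2) by (rule norm_sum_Pythagorean) (auto simp: pairwise_def orthogonal_def *)
  also have "\<dots> = (\<Sum>j\<in>F. (c j)\<^sup>2)"
    by (intro sum.cong refl) (simp add: power_mult_distrib power2_norm_eq_inner *)
  finally show ?thesis .
qed

lemma bessel_inequality_finite:
  assumes "orthonormal_family J e" "finite F" "F \<subseteq> J"
  shows "(\<Sum>j\<in>F. (x \<bullet> e j)\<^sup>2) \<le> (norm x)\<^sup>2"
proof -
  let ?p = "\<Sum>j\<in>F. (x \<bullet> e j) *\<^sub>R e j"
  have "x \<bullet> ?p = (norm ?p)\<^sup>2"
    unfolding orthonormal_family_norm_sum[OF assms] by (simp add: inner_sum_right power2_eq_square)
  then have "(norm (x - ?p))\<^sup>2 = (norm x)\<^sup>2 - (norm ?p)\<^sup>2"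
    by (simp add: power2_norm_eq_inner inner_diff_left inner_diff_right inner_commute)
  then have "(norm ?p)\<^sup>2 \<le> (norm x)\<^sup>2"
    by (smt (verit) zero_le_power2)
  then show ?thesis
    by (simp add: orthonormal_family_norm_sum[OF assms])
qed

text \<open>The half of the Riesz-Fischer theorem that uses completeness: by Pythagoras, the tails of the vector
  series are controlled by the tails of the series of squares, so the net of partial sums is Cauchy.\<close>

lemma orthonormal_series_summable:
  fixes e :: "nat \<Rightarrow> 'a::{real_inner,complete_space}"
  assumes e: "orthonormal_family J e" and c: "(\<lambda>j. (c j)\<^sup>2) summable_on J"
  shows "(\<lambda>j. c j *\<^sub>R e j) summable_on J"
proof -
  let ?f = "\<lambda>j. c j *\<^sub>R e j" and ?g = "\<lambda>j. (c j)\<^sup>2"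
  obtain S where S: "(?g has_sum S) J"
    using c by (auto simp: summable_on_def)
  have "\<exists>P. eventually P (finite_subsets_at_top J) \<and>
              (\<forall>F F'. P F \<and> P F' \<longrightarrow> dist (sum ?f F) (sum ?f F') < \<epsilon>)" if "\<epsilon> > 0" for \<epsilon>
  proof -
    have "\<exists>F0. finite F0 \<and> F0 \<subseteq> J \<and> dist (sum ?g F0) S \<le> (\<epsilon>/2)\<^sup>2 / 2"
      using has_sum_finite_approximation[OF S, of "(\<epsilon>/2)\<^sup>2 / 2"] that by simp
    then obtain F0 where F0: "finite F0" "F0 \<subseteq> J" "dist (sum ?g F0) S \<le> (\<epsilon>/2)\<^sup>2 / 2"
      by blast
    have pos: "(\<epsilon>/2)\<^sup>2 > 0"
      using that by simp
    define P where "P F \<longleftrightarrow> finite F \<and> F0 \<subseteq> F \<and> F \<subseteq> J" for F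
    have near: "dist (sum ?f F) (sum ?f F0) < \<epsilon>/2" if "P F" for F
    proof -
      have F: "finite F" "F0 \<subseteq> F" "F \<subseteq> J"
        using that by (auto simp: P_def)
      have "(dist (sum ?f F) (sum ?f F0))\<^sup>2 = (norm (sum ?f (F - F0)))\<^sup>2"
        unfolding dist_norm using F by (subst sum_diff) auto
      also have "\<dots> = sum ?g (F - F0)"
        using F by (intro orthonormal_family_norm_sum[OF e]) auto
      also have "\<dots> = sum ?g F - sum ?g F0"
        using F by (intro sum_diff) auto
      also have "sum ?g F \<le> S"
        using F by (intro has_sum_mono'[OF has_sum_finite S]) auto
      finally have "(dist (sum ?f F) (sum ?f F0))\<^sup>2 < (\<epsilon>/2)\<^sup>2"
        using F0(3) pos by (simp only: dist_real_def) linarith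
      then show ?thesis
        by (rule power2_less_imp_less) (use \<open>\<epsilon> > 0\<close> in simp)
    qed
    have "dist (sum ?f F) (sum ?f F') < \<epsilon>" if "P F" "P F'" for F F'
      using near[OF that(1)] near[OF that(2)] by (rule dist_triangle_half_l)
    moreover have "eventually P (finite_subsets_at_top J)"
      using F0 by (auto simp: P_def eventually_finite_subsets_at_top)
    ultimately show ?thesis
      by blast
  qed
  then have "cauchy_filter (filtermap (sum ?f) (finite_subsets_at_top J))"
    by (simp add: cauchy_filter_metric_filtermap)
  then obtain s where "(sum ?f \<longlongrightarrow> s) (finite_subsets_at_top J)"
    using complete_UNIV complete_uniform[where S = "UNIV :: 'a set"]
    by (force simp: filterlim_def)
  then show ?thesis
    by (auto simp: summable_on_def has_sum_def)
qed

lemma orthonormal_series_coefficient: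
  assumes e: "orthonormal_family J e" and s: "((\<lambda>j. c j *\<^sub>R e j) has_sum s) J" and i: "i \<in> J"
  shows "s \<bullet> e i = c i"
proof -
  have "((\<lambda>j. (c j *\<^sub>R e j) \<bullet> e i) has_sum s \<bullet> e i) J"
    using s by (rule has_sum_bounded_linear[OF bounded_linear_inner_left])
  moreover have "((\<lambda>j. (c j *\<^sub>R e j) \<bullet> e i) has_sum c i) J"
    using e i by (intro has_sum_finite_neutralI[where B = "{i}"]) (auto simp: orthonormal_family_def)
  ultimately show ?thesis
    by (rule has_sum_unique)
qed

lemma diagonal_series_sum_squares_le:
  assumes e: "orthonormal_family J e" and a: "\<And>j. j \<in> J \<Longrightarrow> \<bar>a j\<bar> \<le> B"
    and F: "finite F" "F \<subseteq> J"
  shows "(\<Sum>j\<in>F. (a j * (x \<bullet> e j))\<^sup>2) \<le> (B * norm x)\<^sup>2"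
proof -
  have "(a j)\<^sup>2 \<le> B\<^sup>2" if "j \<in> F" for j
    using a F that by (intro abs_le_square_iff[THEN iffD1]) fastforce
  then have "(\<Sum>j\<in>F. (a j * (x \<bullet> e j))\<^sup>2) \<le> (\<Sum>j\<in>F. B\<^sup>2 * (x \<bullet> e j)\<^sup>2)"
    unfolding power_mult_distrib by (intro sum_mono mult_right_mono) auto
  also have "\<dots> \<le> B\<^sup>2 * (norm x)\<^sup>2"
    unfolding sum_distrib_left[symmetric]
    by (intro mult_left_mono bessel_inequality_finite[OF e F]) simp
  finally show ?thesis
    by (simp add: power_mult_distrib)
qed

lemma diagonal_series_summable:
  fixes e :: "nat \<Rightarrow> 'a::real_inner" and f :: "nat \<Rightarrow> 'b::{real_inner,complete_space}"
  assumes e: "orthonormal_family J e" and f: "orthonormal_family J f"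
    and a: "\<And>j. j \<in> J \<Longrightarrow> \<bar>a j\<bar> \<le> B"
  shows "(\<lambda>j. (a j * (x \<bullet> e j)) *\<^sub>R f j) summable_on J"
proof (rule orthonormal_series_summable[OF f])
  show "(\<lambda>j. (a j * (x \<bullet> e j))\<^sup>2) summable_on J"
    using diagonal_series_sum_squares_le[OF e a]
    by (intro nonneg_bdd_above_summable_on bdd_aboveI[where M = "(B * norm x)\<^sup>2"]) auto
qed

lemma diagonal_series_norm_le:
  assumes e: "orthonormal_family J e" and f: "orthonormal_family J f"
    and a: "\<And>j. j \<in> J \<Longrightarrow> \<bar>a j\<bar> \<le> B" and B: "0 \<le> B"
    and s: "((\<lambda>j. (a j * (x \<bullet> e j)) *\<^sub>R f j) has_sum s) J"
  shows "norm s \<le> B * norm x"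
proof (rule Lim_norm_ubound)
  show "(sum (\<lambda>j. (a j * (x \<bullet> e j)) *\<^sub>R f j) \<longlongrightarrow> s) (finite_subsets_at_top J)"
    using s by (simp add: has_sum_def)
  have "norm (\<Sum>j\<in>F. (a j * (x \<bullet> e j)) *\<^sub>R f j) \<le> B * norm x" if F: "finite F" "F \<subseteq> J" for F
  proof (rule power2_le_imp_le)
    show "(norm (\<Sum>j\<in>F. (a j * (x \<bullet> e j)) *\<^sub>R f j))\<^sup>2 \<le> (B * norm x)\<^sup>2"
      unfolding orthonormal_family_norm_sum[OF f F]
      by (rule diagonal_series_sum_squares_le[OF e a F])
  qed (use B in simp)
  then show "\<forall>\<^sub>F F in finite_subsets_at_top J. norm (\<Sum>j\<in>F. (a j * (x \<bullet> e j)) *\<^sub>R f j) \<le> B * norm x"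
    by (rule eventually_finite_subsets_at_top_weakI)
qed simp

lemma diagonal_operator_exists:
  fixes e :: "nat \<Rightarrow> 'a::real_inner" and f :: "nat \<Rightarrow> 'b::{real_inner,complete_space}"
  assumes e: "orthonormal_family J e" and f: "orthonormal_family J f"
    and a: "\<And>j. j \<in> J \<Longrightarrow> \<bar>a j\<bar> \<le> B" and B: "0 \<le> B"
  obtains W :: "'a \<Rightarrow>\<^sub>L 'b"
  where "\<And>x. ((\<lambda>j. (a j * (x \<bullet> e j)) *\<^sub>R f j) has_sum blinfun_apply W x) J"
proof
  let ?W = "\<lambda>x. \<Sum>\<^sub>\<infinity>j\<in>J. (a j * (x \<bullet> e j)) *\<^sub>R f j"
  have W: "((\<lambda>j. (a j * (x \<bullet> e j)) *\<^sub>R f j) has_sum ?W x) J" for x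
    by (intro has_sum_infsum diagonal_series_summable[OF e f a])
  have "bounded_linear ?W"
  proof (rule bounded_linear_intro)
    show "?W (x + y) = ?W x + ?W y" for x y
      using has_sum_add[OF W[of x] W[of y]] W[of "x + y"]
      by (auto simp: algebra_simps inner_add_left intro: has_sum_unique)
    show "?W (r *\<^sub>R x) = r *\<^sub>R ?W x" for r x
      using has_sum_scaleR[OF W[of x], of r] W[of "r *\<^sub>R x"]
      by (auto simp: algebra_simps intro: has_sum_unique)
    show "norm (?W x) \<le> norm x * B" for x
      using diagonal_series_norm_le[OF e f a B W] by (simp add: mult.commute)
  qed
  then show "((\<lambda>j. (a j * (x \<bullet> e j)) *\<^sub>R f j) has_sum blinfun_apply (Blinfun ?W) x) J" for x
    using W by (simp add: bounded_linear_Blinfun_apply)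
qed

section \<open>Singular systems\<close>

lemma singular_system_orthonormal:
  assumes "singular_system \<A> J u v \<sigma>"
  shows "orthonormal_family J u" "orthonormal_family J v"
  using assms by (auto simp: singular_system_def orthonormal_basis_of_def)

lemma singular_system_apply:
  assumes S: "singular_system \<A> J u v \<sigma>" and j: "j \<in> J"
  shows "blinfun_apply \<A> (v j) = \<sigma> j *\<^sub>R u j"
proof (rule has_sum_unique)
  show "((\<lambda>i. (\<sigma> i * (v j \<bullet> v i)) *\<^sub>R u i) has_sum blinfun_apply \<A> (v j)) J"
    using S by (simp add: singular_system_def)
  show "((\<lambda>i. (\<sigma> i * (v j \<bullet> v i)) *\<^sub>R u i) has_sum \<sigma> j *\<^sub>R u j) J"
    using singular_system_orthonormal(2)[OF S] j
    by (intro has_sum_finite_neutralI[where B = "{j}"]) (auto simp: orthonormal_family_def)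
qed

lemma singular_value_le_norm:
  assumes S: "singular_system \<A> J u v \<sigma>" and j: "j \<in> J"
  shows "\<bar>\<sigma> j\<bar> \<le> norm \<A>"
proof -
  have "norm (u j) = 1" "norm (v j) = 1"
    using singular_system_orthonormal[OF S] j by (auto simp: orthonormal_family_def norm_eq_1)
  then show ?thesis
    using norm_blinfun[of \<A> "v j"] by (simp add: singular_system_apply[OF S j])
qed

text \<open>The library adjoint is a choice operator, so a candidate has to be exhibited: the series
  \<open>\<Sum>\<^sub>j \<sigma>\<^sub>j \<langle>y, u\<^sub>j\<rangle> v\<^sub>j\<close> converges because the singular values are bounded, and it satisfies the adjoint
  identity, as both sides expand to \<open>\<Sum>\<^sub>j \<sigma>\<^sub>j \<langle>x, v\<^sub>j\<rangle> \<langle>y, u\<^sub>j\<rangle>\<close>.\<close>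

lemma singular_system_adjoint:
  assumes S: "singular_system \<A> J u v \<sigma>"
  shows adjoint_has_sum:
      "((\<lambda>j. (\<sigma> j * (y \<bullet> u j)) *\<^sub>R v j) has_sum adjoint (blinfun_apply \<A>) y) J"
    and adjoint_inner: "blinfun_apply \<A> x \<bullet> y = x \<bullet> adjoint (blinfun_apply \<A>) y"
proof -
  note u = singular_system_orthonormal(1)[OF S] and v = singular_system_orthonormal(2)[OF S]
  obtain W where W: "((\<lambda>j. (\<sigma> j * (y \<bullet> u j)) *\<^sub>R v j) has_sum blinfun_apply W y) J" for y
    using diagonal_operator_exists[OF u v, of \<sigma>] singular_value_le_norm[OF S] norm_ge_zero by blast
  have W_adj: "blinfun_apply \<A> x \<bullet> y = x \<bullet> blinfun_apply W y" for x y
  proof (rule has_sum_unique)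
    have "((\<lambda>j. (\<sigma> j * (x \<bullet> v j)) *\<^sub>R u j) has_sum blinfun_apply \<A> x) J"
      using S by (simp add: singular_system_def)
    then show "((\<lambda>j. ((\<sigma> j * (x \<bullet> v j)) *\<^sub>R u j) \<bullet> y) has_sum blinfun_apply \<A> x \<bullet> y) J"
      by (rule has_sum_bounded_linear[OF bounded_linear_inner_left])
    have "((\<lambda>j. x \<bullet> ((\<sigma> j * (y \<bullet> u j)) *\<^sub>R v j)) has_sum x \<bullet> blinfun_apply W y) J"
      using W by (rule has_sum_bounded_linear[OF bounded_linear_inner_right])
    then show "((\<lambda>j. ((\<sigma> j * (x \<bullet> v j)) *\<^sub>R u j) \<bullet> y) has_sum x \<bullet> blinfun_apply W y) J"
      by (simp add: algebra_simps inner_commute)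
  qed
  have "adjoint (blinfun_apply \<A>) = blinfun_apply W"
    using W_adj by (intro adjoint_unique) simp
  then show "((\<lambda>j. (\<sigma> j * (y \<bullet> u j)) *\<^sub>R v j) has_sum adjoint (blinfun_apply \<A>) y) J"
    and "blinfun_apply \<A> x \<bullet> y = x \<bullet> adjoint (blinfun_apply \<A>) y"
    using W W_adj by auto
qed

lemma normal_operator_coefficient:
  assumes S: "singular_system \<A> J u v \<sigma>" and j: "j \<in> J"
  shows "adjoint (blinfun_apply \<A>) (blinfun_apply \<A> x) \<bullet> v j = (\<sigma> j)\<^sup>2 * (x \<bullet> v j)"
proof -
  have "adjoint (blinfun_apply \<A>) (blinfun_apply \<A> x) \<bullet> v j = blinfun_apply \<A> x \<bullet> blinfun_apply \<A> (v j)"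
    using adjoint_inner[OF S, of "v j" "blinfun_apply \<A> x"] by (simp add: inner_commute)
  also have "\<dots> = \<sigma> j * (blinfun_apply \<A> x \<bullet> u j)"
    by (simp add: singular_system_apply[OF S j])
  also have "blinfun_apply \<A> x \<bullet> u j = \<sigma> j * (x \<bullet> v j)"
    using S j by (intro orthonormal_series_coefficient[of J]) (auto simp: singular_system_def)
  finally show ?thesis
    by (simp add: power2_eq_square)
qed

section \<open>Diagonal affine residual networks\<close>

lemma diagonal_params_coefficients:
  assumes v: "orthonormal_family J v" and D: "diagonal_params J v w \<beta> W b" and j: "j \<in> J"
  shows "blinfun_apply W x \<bullet> v j = w j * (x \<bullet> v j)" and "b \<bullet> v j = \<beta> j"
  using D by (auto simp: diagonal_params_def intro: orthonormal_series_coefficient[OF v _ j])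

lemma resnet_coefficient:
  assumes "orthonormal_family J v" "diagonal_params J v w \<beta> W b" "j \<in> J"
  shows "resnet (W, b) x \<bullet> v j = (1 - w j) * (x \<bullet> v j) - \<beta> j"
  by (simp add: resnet_def residual_fn_def inner_diff_left inner_add_left
      diagonal_params_coefficients[OF assms] algebra_simps)

lemma diagonal_params_unique:
  assumes D: "diagonal_params J v w \<beta> W b" and D': "diagonal_params J v w' \<beta>' W' b'"
    and eq: "\<And>j. j \<in> J \<Longrightarrow> w j = w' j" "\<And>j. j \<in> J \<Longrightarrow> \<beta> j = \<beta>' j"
  shows "W = W'" "b = b'"
proof -
  have "blinfun_apply W x = blinfun_apply W' x" for x
  proof (rule has_sum_unique)
    show "((\<lambda>j. (w j * (x \<bullet> v j)) *\<^sub>R v j) has_sum blinfun_apply W x) J"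
      using D by (simp add: diagonal_params_def)
    show "((\<lambda>j. (w j * (x \<bullet> v j)) *\<^sub>R v j) has_sum blinfun_apply W' x) J"
      using D' eq by (simp add: diagonal_params_def cong: has_sum_cong)
  qed
  then show "W = W'"
    by (rule blinfun_eqI)
  show "b = b'"
    using D D' eq by (auto simp: diagonal_params_def cong: has_sum_cong intro: has_sum_unique)
qed

text \<open>Each \<open>v\<^sub>j\<close> is an eigenvector of \<open>W\<close> for \<open>w\<^sub>j\<close>, which gives one direction; Bessel's inequality gives the
  other.\<close>

lemma diagonal_residual_lipschitz_iff:
  assumes v: "orthonormal_family J v" and D: "diagonal_params J v w \<beta> W b" and L: "0 \<le> L"
  shows "L-lipschitz_on UNIV (residual_fn (W, b)) \<longleftrightarrow> (\<forall>j\<in>J. \<bar>w j\<bar> \<le> L)"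
proof
  assume lip: "L-lipschitz_on UNIV (residual_fn (W, b))"
  show "\<forall>j\<in>J. \<bar>w j\<bar> \<le> L"
  proof
    fix j assume j: "j \<in> J"
    have vj: "v j \<bullet> v j = 1" "norm (v j) = 1"
      using v j by (auto simp: orthonormal_family_def norm_eq_1)
    have "\<bar>w j\<bar> = \<bar>blinfun_apply W (v j) \<bullet> v j\<bar>"
      by (simp add: diagonal_params_coefficients[OF v D j] vj)
    also have "\<dots> \<le> norm (blinfun_apply W (v j))"
      using Cauchy_Schwarz_ineq2[of "blinfun_apply W (v j)" "v j"] vj by simp
    also have "\<dots> \<le> L"
      using lipschitz_onD[OF lip, of "v j" 0] vj by (simp add: residual_fn_def dist_norm)
    finally show "\<bar>w j\<bar> \<le> L" .
  qed
next
  assume w: "\<forall>j\<in>J. \<bar>w j\<bar> \<le> L"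
  have "norm (blinfun_apply W x) \<le> L * norm x" for x
    using D w by (intro diagonal_series_norm_le[OF v v, of w]) (auto simp: diagonal_params_def L)
  then show "L-lipschitz_on UNIV (residual_fn (W, b))"
    by (intro lipschitz_onI L) (simp add: residual_fn_def dist_norm flip: blinfun.diff_right)
qed

text \<open>Solving \<open>\<phi>\<^sub>\<theta>(x) = z\<close> means finding a fixed point of the contraction \<open>x \<mapsto> f\<^sub>\<theta>(x) + z\<close>, so Banach's
  theorem gives both injectivity and surjectivity.\<close>

lemma resnet_bij:
  fixes \<theta> :: "('x::{real_inner,complete_space} \<Rightarrow>\<^sub>L 'x) \<times> 'x"
  assumes "L-lipschitz_on UNIV (residual_fn \<theta>)" "L < 1"
  shows "bij (resnet \<theta>)"
proof -
  have "\<exists>!x. resnet \<theta> x = z" for z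
  proof -
    have "\<exists>!x. residual_fn \<theta> x + z = x"
      using assms lipschitz_on_nonneg[OF assms(1)]
      by (intro banach_fix_type[where c = L]) (auto simp: lipschitz_on_def)
    then show ?thesis
      by (simp add: resnet_def algebra_simps eq_commute)
  qed
  then show ?thesis
    by (metis bijI')
qed

section \<open>The training problem\<close>

lemma has_sum_finite_sum:
  fixes f :: "'i \<Rightarrow> 'j \<Rightarrow> 'a::{topological_comm_monoid_add}"
  assumes "finite I" "\<And>i. i \<in> I \<Longrightarrow> (f i has_sum s i) J"
  shows "((\<lambda>j. \<Sum>i\<in>I. f i j) has_sum (\<Sum>i\<in>I. s i)) J"
  using assms by (induction I rule: finite_induct) (auto intro: has_sum_add has_sum_0)

lemma centered_sum_affine:
  fixes t :: "'i \<Rightarrow> real"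
  assumes "(\<Sum>i\<in>I. t i - m) = 0"
  shows "(\<Sum>i\<in>I. (t i - m) * (a * t i + c)) = a * (\<Sum>i\<in>I. (t i - m)\<^sup>2)"
proof -
  have "(\<Sum>i\<in>I. (t i - m) * (a * t i + c)) = (\<Sum>i\<in>I. a * (t i - m)\<^sup>2 + (a * m + c) * (t i - m))"
    by (intro sum.cong refl) (simp add: algebra_simps power2_eq_square)
  also have "\<dots> = a * (\<Sum>i\<in>I. (t i - m)\<^sup>2)"
    by (simp only: sum.distrib flip: sum_distrib_left) (simp add: assms)
  finally show ?thesis .
qed

lemma data_mean_centered: "(\<Sum>i=1..N. x i \<bullet> v j - data_mean v N x j) = 0"
  by (cases "N = 0") (simp_all add: data_mean_def sum_subtractf)

lemma one_minus_w_opt: "1 - w_opt L \<sigma> j = max ((\<sigma> j)\<^sup>2) (1 - L)"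
  by (simp add: w_opt_def max_def min_def)

text \<open>The optimality of \<open>(w_opt, b_opt)\<close> is a variational inequality. Write \<open>p\<^sub>i\<close> for the residual of the
  optimal network at the sample \<open>x\<^sub>i\<close> and \<open>d\<^sub>i\<close> for the change of output caused by passing to another
  admissible network. The loss changes by \<open>1/N \<Sum>\<^sub>i (\<parallel>d\<^sub>i\<parallel>\<^sup>2 + 2 \<langle>p\<^sub>i, d\<^sub>i\<rangle>)\<close>, and \<open>\<Sum>\<^sub>i \<langle>p\<^sub>i, d\<^sub>i\<rangle> \<ge> 0\<close>: its
  \<open>j\<close>-th coefficient is \<open>\<gamma>\<^sub>j (w_opt\<^sub>j - w\<^sub>j) \<Sum>\<^sub>i (\<langle>x\<^sub>i, v\<^sub>j\<rangle> - \<mu>\<^sub>j)\<^sup>2\<close> with \<open>\<gamma>\<^sub>j = max 0 (1 - L - \<sigma>\<^sub>j\<^sup>2)\<close>, and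
  \<open>\<gamma>\<^sub>j > 0\<close> only where the constraint is active, that is \<open>w_opt\<^sub>j = L \<ge> w\<^sub>j\<close>. The part of \<open>p\<^sub>i\<close> orthogonal to
  all \<open>v\<^sub>j\<close> never enters, since \<open>d\<^sub>i\<close> is a series in the \<open>v\<^sub>j\<close>.\<close>

lemma training_loss_gap:
  assumes S: "singular_system \<A> J u v \<sigma>" and \<mu>: "\<mu> = data_mean v N x"
    and D0: "diagonal_params J v (w_opt L \<sigma>) (b_opt L \<sigma> \<mu>) W0 b0"
    and D: "diagonal_params J v w \<beta> W b" and w: "\<And>j. j \<in> J \<Longrightarrow> w j \<le> L"
  shows "training_loss \<A> N x (W0, b0)
      + 1 / real N * (\<Sum>i=1..N. (norm (resnet (W, b) (x i) - resnet (W0, b0) (x i)))\<^sup>2)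
    \<le> training_loss \<A> N x (W, b)"
proof -
  note v = singular_system_orthonormal(2)[OF S]
  define \<gamma> where "\<gamma> j = max 0 (1 - L - (\<sigma> j)\<^sup>2)" for j
  define p where "p i = resnet (W0, b0) (x i) - adjoint (blinfun_apply \<A>) (blinfun_apply \<A> (x i))" for i
  define d where "d i = resnet (W, b) (x i) - resnet (W0, b0) (x i)" for i
  define a where "a j = w_opt L \<sigma> j - w j" for j
  define c where "c j = b_opt L \<sigma> \<mu> j - \<beta> j" for j
  have p_coeff: "p i \<bullet> v j = \<gamma> j * (x i \<bullet> v j - \<mu> j)" if "j \<in> J" for i j
    unfolding p_def inner_diff_left resnet_coefficient[OF v D0 that] one_minus_w_opt
      normal_operator_coefficient[OF S that] \<gamma>_def b_opt_def
    by (auto simp: max_def algebra_simps)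
  have d_sum: "((\<lambda>j. (a j * (x i \<bullet> v j) + c j) *\<^sub>R v j) has_sum d i) J" for i
  proof -
    have "((\<lambda>j. (w_opt L \<sigma> j * (x i \<bullet> v j)) *\<^sub>R v j + b_opt L \<sigma> \<mu> j *\<^sub>R v j
        + (- 1) *\<^sub>R ((w j * (x i \<bullet> v j)) *\<^sub>R v j + \<beta> j *\<^sub>R v j))
      has_sum (blinfun_apply W0 (x i) + b0 + (- 1) *\<^sub>R (blinfun_apply W (x i) + b))) J"
      using D0 D unfolding diagonal_params_def by (intro has_sum_add has_sum_scaleR) auto
    moreover have "blinfun_apply W0 (x i) + b0 + (- 1) *\<^sub>R (blinfun_apply W (x i) + b) = d i"
      by (simp add: d_def resnet_def residual_fn_def)
    ultimately show ?thesis
      by (simp add: a_def c_def algebra_simps)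
  qed
  have "0 \<le> (\<Sum>i=1..N. p i \<bullet> d i)"
  proof (rule has_sum_nonneg)
    have "((\<lambda>j. p i \<bullet> ((a j * (x i \<bullet> v j) + c j) *\<^sub>R v j)) has_sum p i \<bullet> d i) J" for i
      by (rule has_sum_bounded_linear[OF bounded_linear_inner_right d_sum])
    then show "((\<lambda>j. \<Sum>i=1..N. p i \<bullet> ((a j * (x i \<bullet> v j) + c j) *\<^sub>R v j)) has_sum
        (\<Sum>i=1..N. p i \<bullet> d i)) J"
      by (intro has_sum_finite_sum) auto
    show "0 \<le> (\<Sum>i=1..N. p i \<bullet> ((a j * (x i \<bullet> v j) + c j) *\<^sub>R v j))" if j: "j \<in> J" for j
    proof -
      have "(\<Sum>i=1..N. p i \<bullet> ((a j * (x i \<bullet> v j) + c j) *\<^sub>R v j))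
          = \<gamma> j * (\<Sum>i=1..N. (x i \<bullet> v j - \<mu> j) * (a j * (x i \<bullet> v j) + c j))"
        by (simp add: p_coeff[OF j] sum_distrib_left algebra_simps)
      also have "\<dots> = (\<gamma> j * a j) * (\<Sum>i=1..N. (x i \<bullet> v j - \<mu> j)\<^sup>2)"
        unfolding \<mu> by (subst centered_sum_affine[OF data_mean_centered]) simp
      finally have *: "(\<Sum>i=1..N. p i \<bullet> ((a j * (x i \<bullet> v j) + c j) *\<^sub>R v j))
        = (\<gamma> j * a j) * (\<Sum>i=1..N. (x i \<bullet> v j - \<mu> j)\<^sup>2)" .
      have "0 \<le> \<gamma> j * a j"
        using w[OF j] by (auto simp: \<gamma>_def a_def w_opt_def max_def min_def)
      then show ?thesis
        unfolding * by (rule mult_nonneg_nonneg) (simp add: sum_nonneg)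
    qed
  qed
  moreover have "(\<Sum>i=1..N. (norm (p i + d i))\<^sup>2)
      = (\<Sum>i=1..N. (norm (p i))\<^sup>2) + (\<Sum>i=1..N. (norm (d i))\<^sup>2) + 2 * (\<Sum>i=1..N. p i \<bullet> d i)"
    by (simp add: power2_norm_eq_inner inner_add_left inner_add_right inner_commute
        sum.distrib sum_distrib_left)
  ultimately have "1 / real N * ((\<Sum>i=1..N. (norm (p i))\<^sup>2) + (\<Sum>i=1..N. (norm (d i))\<^sup>2))
      \<le> 1 / real N * (\<Sum>i=1..N. (norm (p i + d i))\<^sup>2)"
    by (intro mult_left_mono) auto
  then show ?thesis
    by (simp add: training_loss_def p_def d_def distrib_left)
qed

lemma optimal_params_exist:
  fixes v :: "nat \<Rightarrow> 'x::{real_inner,complete_space}"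
  assumes v: "orthonormal_family J v" and \<sigma>: "\<And>j. j \<in> J \<Longrightarrow> (\<sigma> j)\<^sup>2 \<le> 1" and L: "0 \<le> L"
  obtains W b where "diagonal_params J v (w_opt L \<sigma>) (b_opt L \<sigma> (data_mean v N x)) W b"
proof -
  have w: "\<bar>w_opt L \<sigma> j\<bar> \<le> L" if "j \<in> J" for j
    using \<sigma>[OF that] L by (auto simp: w_opt_def)
  obtain W where W: "((\<lambda>j. (w_opt L \<sigma> j * (y \<bullet> v j)) *\<^sub>R v j) has_sum blinfun_apply W y) J" for y
    using diagonal_operator_exists[OF v v, of "w_opt L \<sigma>"] w L by blast
  \<comment> \<open>The means \<open>\<mu>\<^sub>j\<close> are the coefficients of the mean vector of the data.\<close>
  define m where "m = (1 / real N) *\<^sub>R (\<Sum>i=1..N. x i)"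
  have "data_mean v N x j = m \<bullet> v j" for j
    by (simp add: data_mean_def m_def inner_sum_left)
  then have "(\<lambda>j. b_opt L \<sigma> (data_mean v N x) j *\<^sub>R v j) summable_on J"
    unfolding b_opt_def using L
    by (auto intro!: diagonal_series_summable[OF v v, where B = 1] order_trans[OF _ zero_le_power2])
  then obtain b where "((\<lambda>j. b_opt L \<sigma> (data_mean v N x) j *\<^sub>R v j) has_sum b) J"
    by (auto simp: summable_on_def)
  with W show thesis
    by (intro that[of W b]) (auto simp: diagonal_params_def)
qed

text \<open>If two diagonal networks agree on the data, then in each coordinate the affine functions
  \<open>t \<mapsto> (1 - w\<^sub>j) t - \<beta>\<^sub>j\<close> agree at all \<open>\<langle>x\<^sub>i, v\<^sub>j\<rangle>\<close>. A sample coordinate different from the mean means that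
  at least two of these points are distinct, and an affine function is determined by two points.\<close>

lemma diagonal_params_determined_by_data:
  assumes v: "orthonormal_family J v"
    and D0: "diagonal_params J v w0 \<beta>0 W0 b0" and D: "diagonal_params J v w \<beta> W b"
    and eq: "\<And>i. i \<in> {1..N} \<Longrightarrow> resnet (W, b) (x i) = resnet (W0, b0) (x i)"
    and nd: "\<forall>j\<in>J. \<exists>i\<in>{1..N}. x i \<bullet> v j \<noteq> data_mean v N x j"
  shows "W = W0" "b = b0"
proof -
  have same: "w j = w0 j \<and> \<beta> j = \<beta>0 j" if j: "j \<in> J" for j
  proof -
    obtain k where k: "k \<in> {1..N}" "x k \<bullet> v j \<noteq> data_mean v N x j"
      using nd j by blast
    have aff: "(w0 j - w j) * (x i \<bullet> v j) = \<beta> j - \<beta>0 j" if "i \<in> {1..N}" for i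
      using resnet_coefficient[OF v D j, of "x i"] resnet_coefficient[OF v D0 j, of "x i"] eq[OF that]
      by (simp add: algebra_simps)
    have "w j = w0 j"
    proof (rule ccontr)
      assume "w j \<noteq> w0 j"
      then have const: "x i \<bullet> v j = x k \<bullet> v j" if "i \<in> {1..N}" for i
        using aff[OF that] aff[OF k(1)] by (metis eq_iff_diff_eq_0 mult_left_cancel)
      have "(\<Sum>i=1..N. x i \<bullet> v j) = (\<Sum>i=1..N. x k \<bullet> v j)"
        using const by (rule sum.cong[OF refl])
      then have "data_mean v N x j = x k \<bullet> v j"
        using k(1) by (simp add: data_mean_def)
      with k(2) show False
        by simp
    qed
    with aff[OF k(1)] show ?thesis
      by simp
  qed
  show "W = W0" "b = b0"
    using diagonal_params_unique[OF D D0] same by auto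
qed

text \<open>The loss of a minimiser is at most that of \<open>(W0, b0)\<close>, so the gap forces it to produce the same outputs
  on the data, and these determine it.\<close>

lemma training_solution_iff:
  assumes S: "singular_system \<A> J u v \<sigma>" and norm: "norm \<A> \<le> 1" and L: "0 \<le> L"
    and \<mu>: "\<mu> = data_mean v N x" and nd: "\<forall>j\<in>J. \<exists>i\<in>{1..N}. x i \<bullet> v j \<noteq> \<mu> j"
    and D0: "diagonal_params J v (w_opt L \<sigma>) (b_opt L \<sigma> \<mu>) W0 b0"
  shows "training_solution \<A> J v L N x \<theta> \<longleftrightarrow> \<theta> = (W0, b0)"
proof -
  note v = singular_system_orthonormal(2)[OF S]
  have gap: "training_loss \<A> N x (W0, b0)
      + 1 / real N * (\<Sum>i=1..N. (norm (resnet (W, b) (x i) - resnet (W0, b0) (x i)))\<^sup>2)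
    \<le> training_loss \<A> N x (W, b)"
    if D: "diagonal_params J v w \<beta> W b" and lip: "L-lipschitz_on UNIV (residual_fn (W, b))"
    for w \<beta> W b
    using training_loss_gap[OF S \<mu> D0 D] diagonal_residual_lipschitz_iff[OF v D L] lip
    by fastforce
  have w: "\<bar>w_opt L \<sigma> j\<bar> \<le> L" if "j \<in> J" for j
  proof -
    have "(\<sigma> j)\<^sup>2 \<le> 1"
      using singular_value_le_norm[OF S that] norm by (simp add: abs_square_le_1)
    then show ?thesis
      using L by (auto simp: w_opt_def)
  qed
  have feasible: "(W0, b0) \<in> Theta J v \<and> L-lipschitz_on UNIV (residual_fn (W0, b0))"
    using D0 w diagonal_residual_lipschitz_iff[OF v D0 L] by (auto simp: Theta_def)
  show ?thesis
  proof
    assume sol: "training_solution \<A> J v L N x \<theta>"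
    obtain W b where \<theta>: "\<theta> = (W, b)"
      by fastforce
    from sol obtain w \<beta> where D: "diagonal_params J v w \<beta> W b"
      and lip: "L-lipschitz_on UNIV (residual_fn (W, b))"
      by (auto simp: training_solution_def is_arg_min_def Theta_def \<theta>)
    have "training_loss \<A> N x (W, b) \<le> training_loss \<A> N x (W0, b0)"
      using sol feasible by (auto simp: training_solution_def is_arg_min_def \<theta> not_less)
    with gap[OF D lip]
    have "1 / real N * (\<Sum>i=1..N. (norm (resnet (W, b) (x i) - resnet (W0, b0) (x i)))\<^sup>2) \<le> 0"
      by linarith
    then have "(\<Sum>i=1..N. (norm (resnet (W, b) (x i) - resnet (W0, b0) (x i)))\<^sup>2) \<le> 0"
      by (cases "N = 0") (simp_all add: field_simps)
    then have "(\<Sum>i=1..N. (norm (resnet (W, b) (x i) - resnet (W0, b0) (x i)))\<^sup>2) = 0"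
      by (intro antisym sum_nonneg) auto
    then have "resnet (W, b) (x i) = resnet (W0, b0) (x i)" if "i \<in> {1..N}" for i
      using that by (subst (asm) sum_nonneg_eq_0_iff) auto
    from diagonal_params_determined_by_data[OF v D0 D this] nd
    show "\<theta> = (W0, b0)"
      by (simp add: \<theta> \<mu>)
  next
    assume \<theta>: "\<theta> = (W0, b0)"
    have "training_loss \<A> N x (W0, b0) \<le> training_loss \<A> N x \<eta>"
      if \<eta>: "\<eta> \<in> Theta J v" "L-lipschitz_on UNIV (residual_fn \<eta>)" for \<eta>
    proof -
      obtain W b where Wb: "\<eta> = (W, b)"
        by fastforce
      obtain w \<beta> where D: "diagonal_params J v w \<beta> W b"
        using \<eta>(1) by (auto simp: Theta_def Wb)
      have "0 \<le> 1 / real N * (\<Sum>i=1..N. (norm (resnet (W, b) (x i) - resnet (W0, b0) (x i)))\<^sup>2)"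
        by (intro mult_nonneg_nonneg sum_nonneg) auto
      with gap[OF D] \<eta>(2) show ?thesis
        by (fastforce simp: Wb)
    qed
    with feasible show "training_solution \<A> J v L N x \<theta>"
      by (auto simp: training_solution_def is_arg_min_def \<theta> not_less)
  qed
qed

section \<open>The regularised inverse\<close>

lemma r_hat_abs_le:
  assumes "L < 1"
  shows "\<bar>r_hat L s\<bar> \<le> 1 / (1 - L)"
  using assms by (simp add: r_hat_def frac_le)

lemma T_op_series_summable:
  assumes S: "singular_system \<A> J u v \<sigma>" and L: "L < 1"
  shows "(\<lambda>j. (r_hat L ((\<sigma> j)\<^sup>2) * \<sigma> j * (y \<bullet> u j)) *\<^sub>R v j) summable_on J"
proof (rule diagonal_series_summable[OF singular_system_orthonormal[OF S]])
  show "\<bar>r_hat L ((\<sigma> j)\<^sup>2) * \<sigma> j\<bar> \<le> 1 / (1 - L) * norm \<A>" if "j \<in> J" for j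
    unfolding abs_mult using r_hat_abs_le[OF L] singular_value_le_norm[OF S that] L
    by (intro mult_mono) auto
qed

text \<open>In the coordinate \<open>j\<close> the optimal network multiplies by \<open>1 - w_opt\<^sub>j = max \<sigma>\<^sub>j\<^sup>2 (1 - L)\<close>, which is the
  reciprocal of \<open>r_hat\<close>, and then subtracts \<open>b_opt\<^sub>j\<close>. Wherever \<open>b_opt\<^sub>j \<noteq> 0\<close> this factor is \<open>1 - L\<close>, which explains
  the constant prefactor in \<open>b_hat\<close>.\<close>

lemma resnet_T_op:
  assumes S: "singular_system \<A> J u v \<sigma>" and L: "L < 1"
    and D: "diagonal_params J v (w_opt L \<sigma>) (b_opt L \<sigma> \<mu>) W b"
  shows "resnet (W, b) (T_op J u v \<sigma> L \<mu> y) = adjoint (blinfun_apply \<A>) y"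
proof (rule has_sum_unique)
  note v = singular_system_orthonormal(2)[OF S]
  let ?t = "T_op J u v \<sigma> L \<mu> y"
  define c where "c j = b_opt L \<sigma> \<mu> j / (1 - L) + r_hat L ((\<sigma> j)\<^sup>2) * \<sigma> j * (y \<bullet> u j)" for j
  have b: "((\<lambda>j. b_opt L \<sigma> \<mu> j *\<^sub>R v j) has_sum b) J"
    using D by (simp add: diagonal_params_def)
  then have "b_hat J v \<sigma> L \<mu> = (1 / (1 - L)) *\<^sub>R b"
    by (simp add: b_hat_def infsumI)
  then have "((\<lambda>j. (1 / (1 - L)) *\<^sub>R b_opt L \<sigma> \<mu> j *\<^sub>R v j
      + (r_hat L ((\<sigma> j)\<^sup>2) * \<sigma> j * (y \<bullet> u j)) *\<^sub>R v j) has_sum ?t) J"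
    using has_sum_add[OF has_sum_scaleR[OF b, of "1 / (1 - L)"]
        has_sum_infsum[OF T_op_series_summable[OF S L, of y]]]
    by (simp add: T_op_def)
  then have t: "((\<lambda>j. c j *\<^sub>R v j) has_sum ?t) J"
    by (simp add: c_def algebra_simps)
  have "((\<lambda>j. (w_opt L \<sigma> j * (?t \<bullet> v j)) *\<^sub>R v j) has_sum blinfun_apply W ?t) J"
    using D by (simp add: diagonal_params_def)
  then have network: "((\<lambda>j. c j *\<^sub>R v j + (- 1) *\<^sub>R ((w_opt L \<sigma> j * (?t \<bullet> v j)) *\<^sub>R v j + b_opt L \<sigma> \<mu> j *\<^sub>R v j))
      has_sum (?t + (- 1) *\<^sub>R (blinfun_apply W ?t + b))) J"
    by (intro has_sum_add has_sum_scaleR t b)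
  have network_value: "?t + (- 1) *\<^sub>R (blinfun_apply W ?t + b) = resnet (W, b) ?t"
    by (simp add: resnet_def residual_fn_def)
  have coeff: "c j *\<^sub>R v j + (- 1) *\<^sub>R ((w_opt L \<sigma> j * (?t \<bullet> v j)) *\<^sub>R v j + b_opt L \<sigma> \<mu> j *\<^sub>R v j)
      = (\<sigma> j * (y \<bullet> u j)) *\<^sub>R v j" if j: "j \<in> J" for j
  proof -
    have "max ((\<sigma> j)\<^sup>2) (1 - L) * r_hat L ((\<sigma> j)\<^sup>2) = 1"
      using L by (auto simp: r_hat_def max_def)
    moreover have "max ((\<sigma> j)\<^sup>2) (1 - L) * (b_opt L \<sigma> \<mu> j / (1 - L)) = b_opt L \<sigma> \<mu> j"
      using L by (auto simp: b_opt_def max_def)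
    moreover have "(1 - w_opt L \<sigma> j) * c j = max ((\<sigma> j)\<^sup>2) (1 - L) * (b_opt L \<sigma> \<mu> j / (1 - L))
        + max ((\<sigma> j)\<^sup>2) (1 - L) * r_hat L ((\<sigma> j)\<^sup>2) * (\<sigma> j * (y \<bullet> u j))"
      unfolding c_def one_minus_w_opt by (simp only: distrib_left mult.assoc)
    ultimately have "(1 - w_opt L \<sigma> j) * c j - b_opt L \<sigma> \<mu> j = \<sigma> j * (y \<bullet> u j)"
      by simp
    moreover have "c j *\<^sub>R v j + (- 1) *\<^sub>R ((w_opt L \<sigma> j * c j) *\<^sub>R v j + b_opt L \<sigma> \<mu> j *\<^sub>R v j)
        = ((1 - w_opt L \<sigma> j) * c j - b_opt L \<sigma> \<mu> j) *\<^sub>R v j"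
      by (simp add: algebra_simps)
    moreover have "?t \<bullet> v j = c j"
      using v t j by (rule orthonormal_series_coefficient)
    ultimately show ?thesis
      by simp
  qed
  show "((\<lambda>j. (\<sigma> j * (y \<bullet> u j)) *\<^sub>R v j) has_sum resnet (W, b) ?t) J"
    using iffD1[OF has_sum_cong[OF coeff] network] unfolding network_value .
  show "((\<lambda>j. (\<sigma> j * (y \<bullet> u j)) *\<^sub>R v j) has_sum adjoint (blinfun_apply \<A>) y) J"
    by (rule adjoint_has_sum[OF S])
qed

lemma b_hat_has_sum:
  assumes "(\<lambda>j. b_opt L \<sigma> \<mu> j *\<^sub>R v j) summable_on J"
  shows "((\<lambda>j. ((1 - L - (\<sigma> j)\<^sup>2) / (1 - L) * \<mu> j) *\<^sub>R v j) has_sum b_hat J v \<sigma> L \<mu>)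
    {j \<in> J. (\<sigma> j)\<^sup>2 < 1 - L}"
proof -
  have "((\<lambda>j. (1 / (1 - L)) *\<^sub>R b_opt L \<sigma> \<mu> j *\<^sub>R v j) has_sum b_hat J v \<sigma> L \<mu>) J"
    unfolding b_hat_def by (intro has_sum_scaleR has_sum_infsum assms)
  then show ?thesis
    by (rule iffD1[OF has_sum_cong_neutral, rotated -1]) (auto simp: b_opt_def)
qed

theorem lemma4p2:
  fixes \<A> :: "'x::{real_inner,complete_space} \<Rightarrow>\<^sub>L 'y::{real_inner,complete_space}"
    and J :: "nat set"
    and u :: "nat \<Rightarrow> 'y" and v :: "nat \<Rightarrow> 'x" and \<sigma> :: "nat \<Rightarrow> real"
    and L :: real and N :: nat and x :: "nat \<Rightarrow> 'x" and \<mu> :: "nat \<Rightarrow> real"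
  assumes "norm \<A> = 1"
    and "singular_system \<A> J u v \<sigma>"
    and "0 \<le> L" and "L < 1"
    and "\<mu> = data_mean v N x"
    and "\<forall>j\<in>J. \<exists>i\<in>{1..N}. x i \<bullet> v j \<noteq> \<mu> j"
  shows "(\<exists>!\<theta>. training_solution \<A> J v L N x \<theta>) \<and>
    (\<forall>W b. training_solution \<A> J v L N x (W, b) \<longrightarrow>
       diagonal_params J v (w_opt L \<sigma>) (b_opt L \<sigma> \<mu>) W b \<and>
       bij (resnet (W, b)) \<and>
       inv (resnet (W, b)) \<circ> adjoint (blinfun_apply \<A>) = T_op J u v \<sigma> L \<mu>) \<and>
    (\<forall>y. (\<lambda>j. (r_hat L ((\<sigma> j)\<^sup>2) * \<sigma> j * (y \<bullet> u j)) *\<^sub>R v j) summable_on J) \<and>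
    ((\<lambda>j. ((1 - L - (\<sigma> j)\<^sup>2) / (1 - L) * \<mu> j) *\<^sub>R v j) has_sum b_hat J v \<sigma> L \<mu>)
       {j \<in> J. (\<sigma> j)\<^sup>2 < 1 - L}"
proof -
  note S = assms(2) and \<mu> = assms(5)
  note v = singular_system_orthonormal(2)[OF S]
  have \<sigma>: "(\<sigma> j)\<^sup>2 \<le> 1" if "j \<in> J" for j
    using singular_value_le_norm[OF S that] assms(1) by (simp add: abs_square_le_1)
  obtain W0 b0 where D0: "diagonal_params J v (w_opt L \<sigma>) (b_opt L \<sigma> \<mu>) W0 b0"
    using optimal_params_exist[OF v, of \<sigma>] \<sigma> assms(3) unfolding \<mu> by blast
  have sol: "training_solution \<A> J v L N x \<theta> \<longleftrightarrow> \<theta> = (W0, b0)" for \<theta>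
    using training_solution_iff[OF S _ assms(3) \<mu> assms(6) D0] assms(1) by simp
  have "L-lipschitz_on UNIV (residual_fn (W0, b0))"
    using sol[of "(W0, b0)"] by (simp add: training_solution_def is_arg_min_def)
  then have bij: "bij (resnet (W0, b0))"
    using assms(4) by (rule resnet_bij)
  have "inv (resnet (W0, b0)) \<circ> adjoint (blinfun_apply \<A>) = T_op J u v \<sigma> L \<mu>"
    using resnet_T_op[OF S assms(4) D0] bij_is_inj[OF bij] by (intro ext) (simp add: inv_f_eq)
  moreover have "(\<lambda>j. b_opt L \<sigma> \<mu> j *\<^sub>R v j) summable_on J"
    using D0 by (auto simp: diagonal_params_def summable_on_def)
  ultimately show ?thesis
    using D0 bij T_op_series_summable[OF S assms(4)] b_hat_has_sum by (simp add: sol)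
qed

end
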